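(* For every integer $k\geq 2$ there exist a Minkowski space $X$ of dimension $2^{k}-1$ and a convex body $K\subset X$ such that $K$ is (diametrically) complete in $X$ but $K$ is not reduced in $X$.
   Context: A Minkowski space $X=(\mathbb{R}^m,\|\cdot\|)$ is a finite-dimensional real normed space. A convex body in $X$ is a compact convex set with nonempty interior. The width of a convex body $K$ in direction $u$ (a nonzero vector) is the distance, measured in the norm $\|\cdot\|$, between the two parallel supporting hyperplanes of $K$ that are orthogonal (in the Euclidean sense) to $u$. The thickness $\Delta(K)$ is the minimum of the width over all directions $u$, and the diameter $\delta(K)$ is the maximum of the width over all directions; the latter equals $\max\{\|x-y\|: x,y\in K\}$, which is also the definition of diameter for arbitrary nonempty compact sets. A convex body is (diametrically) complete in $X$ if it is not properly contained in a compact set of the same diameter. A convex body $R$ is reduced in $X$ if $\Delta(C)<\Delta(R)$ for every convex body $C$ properly contained in $R$. *)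

theory Defs
  imports "HOL-Analysis.Analysis"
begin

text \<open>
  A Minkowski space of dimension \<open>m\<close> is the type \<open>real ^ 'n\<close> with \<open>CARD('n) = m\<close> together with an
  arbitrary norm \<open>N\<close>, which need not be the Euclidean norm of the type class. As all norms on
  \<open>real ^ 'n\<close> induce the same topology, \<open>compact\<close> and \<open>interior\<close> may be taken from the type class.
\<close>

definition is_norm :: "(real ^ 'n \<Rightarrow> real) \<Rightarrow> bool" where
  "is_norm N \<longleftrightarrow>
     (\<forall>x. 0 \<le> N x) \<and>
     (\<forall>x. N x = 0 \<longleftrightarrow> x = 0) \<and>
     (\<forall>c x. N (c *\<^sub>R x) = \<bar>c\<bar> * N x) \<and>
     (\<forall>x y. N (x + y) \<le> N x + N y)"

definition convex_body :: "(real ^ 'n) set \<Rightarrow> bool" where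
  "convex_body K \<longleftrightarrow> compact K \<and> convex K \<and> interior K \<noteq> {}"

definition set_distance :: "(real ^ 'n \<Rightarrow> real) \<Rightarrow> (real ^ 'n) set \<Rightarrow> (real ^ 'n) set \<Rightarrow> real" where
  "set_distance N A B = Inf {N (x - y) | x y. x \<in> A \<and> y \<in> B}"

text \<open>The two supporting hyperplanes of \<open>K\<close> that are Euclidean-orthogonal to \<open>u\<close>.\<close>

definition upper_hyperplane :: "(real ^ 'n) set \<Rightarrow> real ^ 'n \<Rightarrow> (real ^ 'n) set" where
  "upper_hyperplane K u = {x. u \<bullet> x = (SUP y\<in>K. u \<bullet> y)}"

definition lower_hyperplane :: "(real ^ 'n) set \<Rightarrow> real ^ 'n \<Rightarrow> (real ^ 'n) set" where
  "lower_hyperplane K u = {x. u \<bullet> x = (INF y\<in>K. u \<bullet> y)}"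

definition width :: "(real ^ 'n \<Rightarrow> real) \<Rightarrow> (real ^ 'n) set \<Rightarrow> real ^ 'n \<Rightarrow> real" where
  "width N K u = set_distance N (upper_hyperplane K u) (lower_hyperplane K u)"

text \<open>
  For a convex body the infimum below is attained: the width does not change when \<open>u\<close> is rescaled,
  and it is continuous on the Euclidean unit sphere. Likewise, the supremum in the diameter is
  attained for every nonempty compact set.
\<close>

definition thickness :: "(real ^ 'n \<Rightarrow> real) \<Rightarrow> (real ^ 'n) set \<Rightarrow> real" where
  "thickness N K = (INF u\<in>{u. u \<noteq> 0}. width N K u)"

definition norm_diameter :: "(real ^ 'n \<Rightarrow> real) \<Rightarrow> (real ^ 'n) set \<Rightarrow> real" where
  "norm_diameter N S = Sup {N (x - y) | x y. x \<in> S \<and> y \<in> S}"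

text \<open>The next two notions are meant for convex bodies only; they do not themselves require it.\<close>

definition diametrically_complete :: "(real ^ 'n \<Rightarrow> real) \<Rightarrow> (real ^ 'n) set \<Rightarrow> bool" where
  "diametrically_complete N K \<longleftrightarrow>
     \<not> (\<exists>C. compact C \<and> K \<subset> C \<and> norm_diameter N C = norm_diameter N K)"

definition reduced_in :: "(real ^ 'n \<Rightarrow> real) \<Rightarrow> (real ^ 'n) set \<Rightarrow> bool" where
  "reduced_in N R \<longleftrightarrow> (\<forall>C. convex_body C \<and> C \<subset> R \<longrightarrow> thickness N C < thickness N R)"

end

theory Submission
  imports Defs
begin

text \<open>
  Let \<open>T\<close> be a simplex with barycentric coordinates \<open>f\<^sub>0, \<dots>, f\<^sub>n\<close>, and let the unit ball consist of
  the vectors on which the linear part of every \<open>f\<^sub>i\<close> has modulus at most \<open>1\<close>. A point outside \<open>T\<close>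
  has some negative coordinate \<open>f\<^sub>i\<close>, hence distance greater than \<open>1\<close> from the vertex where
  \<open>f\<^sub>i = 1\<close>; so \<open>T\<close>, which has diameter \<open>1\<close>, is complete. The ball of radius \<open>1 / (n + 1)\<close> about the
  centroid lies in \<open>T\<close> and has width \<open>2 / (n + 1)\<close> in every direction. If \<open>n\<close> is odd, the sum of half
  of the \<open>f\<^sub>i\<close> ranges over \<open>[0, 1]\<close> on \<open>T\<close> and over \<open>[-(n + 1) / 2, (n + 1) / 2]\<close> on the unit
  ball, so \<open>T\<close> itself is no thicker than this inscribed ball. Taking \<open>f\<^sub>1, \<dots>, f\<^sub>n\<close> to be the standard
  coordinates gives \<open>f\<^sub>0 = 1 - (f\<^sub>1 + \<dots> + f\<^sub>n)\<close>.
\<close>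

section \<open>The polyhedral norm and its balls\<close>

text \<open>The sum is, up to sign, the linear part of \<open>f\<^sub>0\<close>; the components are
  the linear parts of the other barycentric coordinates.\<close>

definition simplex_norm :: "real ^ 'n \<Rightarrow> real" where
  "simplex_norm x = Max (insert \<bar>\<Sum>i\<in>UNIV. x $ i\<bar> (range (\<lambda>i. \<bar>x $ i\<bar>)))"

definition corner_simplex :: "(real ^ 'n) set" where
  "corner_simplex = {x. (\<forall>i. 0 \<le> x $ i) \<and> (\<Sum>i\<in>UNIV. x $ i) \<le> 1}"

lemma simplex_norm_le_iff:
  fixes x :: "real ^ 'n"
  shows "simplex_norm x \<le> r \<longleftrightarrow> (\<forall>i. \<bar>x $ i\<bar> \<le> r) \<and> \<bar>\<Sum>i\<in>UNIV. x $ i\<bar> \<le> r"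
  unfolding simplex_norm_def by (subst Max_le_iff) auto

lemma abs_component_le_simplex_norm: "\<bar>x $ i\<bar> \<le> simplex_norm x"
  and abs_sum_le_simplex_norm: "\<bar>\<Sum>i\<in>UNIV. x $ i\<bar> \<le> simplex_norm x"
  using simplex_norm_le_iff[of x "simplex_norm x"] by auto

lemma is_norm_simplex_norm: "is_norm (simplex_norm :: real ^ 'n \<Rightarrow> real)"
  unfolding is_norm_def
proof (intro conjI allI)
  fix x y :: "real ^ 'n" and c :: real
  show nonneg: "0 \<le> simplex_norm x" for x :: "real ^ 'n"
    using abs_sum_le_simplex_norm[of x] by linarith
  show "simplex_norm x = 0 \<longleftrightarrow> x = 0"
  proof
    assume "simplex_norm x = 0"
    then show "x = 0"
      using abs_component_le_simplex_norm[of x] by (simp add: vec_eq_iff)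
  next
    assume "x = 0"
    then have "simplex_norm x \<le> 0" by (simp add: simplex_norm_le_iff)
    then show "simplex_norm x = 0" using nonneg[of x] by linarith
  qed
  have scale_le: "simplex_norm (c *\<^sub>R x) \<le> \<bar>c\<bar> * simplex_norm x" for c and x :: "real ^ 'n"
    unfolding simplex_norm_le_iff vector_scaleR_component real_scaleR_def abs_mult
      sum_distrib_left[symmetric]
    by (intro conjI allI mult_left_mono abs_component_le_simplex_norm abs_sum_le_simplex_norm
        abs_ge_zero)
  show "simplex_norm (c *\<^sub>R x) = \<bar>c\<bar> * simplex_norm x"
  proof (cases "c = 0")
    case True
    then show ?thesis using scale_le[of c x] nonneg[of "c *\<^sub>R x"] by simp
  next
    case False
    \<comment> \<open>Applying \<open>scale_le\<close> to \<open>inverse c\<close> and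
      \<open>c *\<^sub>R x\<close> yields the reverse inequality.\<close>
    then have "\<bar>c\<bar> * simplex_norm x \<le> simplex_norm (c *\<^sub>R x)"
      using scale_le[of "inverse c" "c *\<^sub>R x"] by (simp add: field_simps)
    then show ?thesis using scale_le[of c x] by simp
  qed
  show "simplex_norm (x + y) \<le> simplex_norm x + simplex_norm y"
    unfolding simplex_norm_le_iff vector_add_component sum.distrib
    by (intro conjI allI order_trans[OF abs_triangle_ineq] add_mono
        abs_component_le_simplex_norm abs_sum_le_simplex_norm)
qed

text \<open>Comparison with the Euclidean norm: it gives norm balls nonempty interior and keeps the
  distances within a compact set bounded.\<close>

lemma simplex_norm_le_norm:
  fixes x :: "real ^ 'n"
  shows "simplex_norm x \<le> real CARD('n) * norm x"
proof -
  have comp: "\<bar>x $ i\<bar> \<le> norm x" for i by (rule component_le_norm_cart)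
  have "\<bar>x $ i\<bar> \<le> real CARD('n) * norm x" for i
    using comp[of i] mult_right_mono[of 1 "real CARD('n)" "norm x"] by (simp add: Suc_leI)
  moreover have "\<bar>\<Sum>i\<in>UNIV. x $ i\<bar> \<le> (\<Sum>i\<in>(UNIV :: 'n set). norm x)"
    using comp by (intro order_trans[OF sum_abs] sum_mono)
  ultimately show ?thesis by (simp add: simplex_norm_le_iff)
qed

lemma convex_body_simplex_ball:
  fixes c :: "real ^ 'n"
  assumes "0 < r"
  shows "convex_body {x. simplex_norm (x - c) \<le> r}" (is "convex_body ?B")
  unfolding convex_body_def
proof (intro conjI)
  have eq: "?B = {x. (\<forall>i. \<bar>(x - c) $ i\<bar> \<le> r) \<and> \<bar>\<Sum>i\<in>UNIV. (x - c) $ i\<bar> \<le> r}"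
    by (simp add: simplex_norm_le_iff)
  have "closed ?B"
    unfolding eq
    by (intro closed_Collect_conj closed_Collect_all closed_Collect_le continuous_intros)
  moreover have "bounded ?B"
  proof (rule boundedI)
    fix x assume "x \<in> ?B"
    then have "\<bar>x $ i\<bar> \<le> r + \<bar>c $ i\<bar>" for i
      using abs_component_le_simplex_norm[of "x - c" i] by simp
    then show "norm x \<le> (\<Sum>i\<in>UNIV. r + \<bar>c $ i\<bar>)"
      by (intro order_trans[OF norm_le_l1_cart] sum_mono)
  qed
  ultimately show "compact ?B" by (simp add: compact_eq_bounded_closed)
  have norm_add: "simplex_norm (a + b) \<le> simplex_norm a + simplex_norm b"
    and norm_scale: "simplex_norm (t *\<^sub>R a) = \<bar>t\<bar> * simplex_norm a" for a b :: "real ^ 'n" and t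
    using is_norm_simplex_norm unfolding is_norm_def by blast+
  show "convex ?B"
  proof (rule convexI)
    fix x y and u v :: real
    assume *: "x \<in> ?B" "y \<in> ?B" "0 \<le> u" "0 \<le> v" "u + v = 1"
    then have v: "v = 1 - u" by simp
    have "u *\<^sub>R x + v *\<^sub>R y - c = u *\<^sub>R (x - c) + v *\<^sub>R (y - c)"
      unfolding v by (simp add: algebra_simps)
    moreover have "simplex_norm (u *\<^sub>R (x - c) + v *\<^sub>R (y - c))
        \<le> u * simplex_norm (x - c) + v * simplex_norm (y - c)"
      using norm_add[of "u *\<^sub>R (x - c)" "v *\<^sub>R (y - c)"] *
      by (simp only: norm_scale abs_of_nonneg)
    moreover have "\<dots> \<le> u * r + v * r" using * by (intro add_mono mult_left_mono) auto
    moreover have "\<dots> = r" unfolding v by (simp add: algebra_simps)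
    ultimately show "u *\<^sub>R x + v *\<^sub>R y \<in> ?B" by simp
  qed
  have "ball c (r / CARD('n)) \<subseteq> ?B"
  proof
    fix x assume "x \<in> ball c (r / CARD('n))"
    then have "real CARD('n) * norm (x - c) \<le> r"
      by (simp add: dist_norm norm_minus_commute field_simps)
    then show "x \<in> ?B" using simplex_norm_le_norm[of "x - c"] by simp
  qed
  then have "c \<in> interior ?B"
    using assms unfolding mem_interior by (intro exI[of _ "r / CARD('n)"]) simp
  then show "interior ?B \<noteq> {}" by blast
qed

section \<open>Estimates for width and thickness\<close>

lemma exists_hyperplane_point:
  fixes u :: "real ^ 'n"
  assumes "u \<noteq> 0"
  shows "\<exists>x. u \<bullet> x = a"
  using assms by (intro exI[of _ "(a / (u \<bullet> u)) *\<^sub>R u"]) simp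

text \<open>For \<open>u \<noteq> 0\<close> both hyperplanes are nonempty, so the infimum runs over
  a nonempty set and lower bounds pass to it.\<close>

lemma width_geI:
  assumes "u \<noteq> 0"
    and "\<And>x y. x \<in> upper_hyperplane K u \<Longrightarrow> y \<in> lower_hyperplane K u \<Longrightarrow> w \<le> N (x - y)"
  shows "w \<le> width N K u"
  unfolding width_def set_distance_def
proof (rule cInf_greatest)
  obtain x y where "u \<bullet> x = (SUP y\<in>K. u \<bullet> y)" "u \<bullet> y = (INF y\<in>K. u \<bullet> y)"
    using exists_hyperplane_point[OF assms(1)] by metis
  then show "{N (x - y) |x y. x \<in> upper_hyperplane K u \<and> y \<in> lower_hyperplane K u} \<noteq> {}"
    unfolding upper_hyperplane_def lower_hyperplane_def by blast
qed (use assms(2) in blast)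

text \<open>One direction and one pair of points suffice, because both infima, over directions and
  over pairs, are bounded below by \<open>0\<close>.\<close>

lemma thickness_le:
  assumes N: "is_norm N" and "u \<noteq> 0"
    and xy: "x \<in> upper_hyperplane K u" "y \<in> lower_hyperplane K u"
  shows "thickness N K \<le> N (x - y)"
proof -
  have nonneg: "0 \<le> N z" for z using N by (auto simp: is_norm_def)
  have "thickness N K \<le> width N K u"
    unfolding thickness_def using nonneg \<open>u \<noteq> 0\<close>
    by (intro cINF_lower bdd_belowI2[where m = 0] width_geI) auto
  also have "\<dots> \<le> N (x - y)"
    unfolding width_def set_distance_def using xy nonneg
    by (intro cInf_lower bdd_belowI[where m = 0]) auto
  finally show ?thesis .
qed

text \<open>Opposite boundary points of the ball lie between the hyperplanes, so
  \<open>u \<bullet> (x - y)\<close> is at least \<open>2 * r\<close> times the dual norm of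
  \<open>u\<close>; it is also at most that dual norm times \<open>N (x - y)\<close>.\<close>

lemma thickness_ball_ge:
  assumes N: "is_norm N" and "compact {x. N (x - c) \<le> r}" and "0 < r"
  shows "2 * r \<le> thickness N {x. N (x - c) \<le> r}" (is "_ \<le> thickness N ?B")
  unfolding thickness_def
proof (rule cINF_greatest)
  show "{u :: real ^ 'a. u \<noteq> 0} \<noteq> {}"
    using axis_eq_0_iff[of undefined "1 :: real"] by blast
next
  fix u :: "real ^ 'a" assume "u \<in> {u. u \<noteq> 0}"
  then have u: "u \<noteq> 0" by simp
  have scale: "N (a *\<^sub>R z) = \<bar>a\<bar> * N z" and pos: "z \<noteq> 0 \<Longrightarrow> 0 < N z" for a z
    using N by (auto simp: is_norm_def less_le)
  show "2 * r \<le> width N ?B u"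
  proof (rule width_geI[OF u])
    fix x y assume x: "x \<in> upper_hyperplane ?B u" and y: "y \<in> lower_hyperplane ?B u"
    have bdd: "bounded ((\<bullet>) u ` ?B)"
      using assms(2) by (intro compact_imp_bounded compact_continuous_image continuous_intros)
    \<comment> \<open>Ranging over all unit vectors \<open>b\<close> replaces an explicit dual
      norm.\<close>
    have ineq: "2 * r * (u \<bullet> b) \<le> u \<bullet> (x - y)" if "N b = 1" for b
    proof -
      have "c + r *\<^sub>R b \<in> ?B" "c + (- r) *\<^sub>R b \<in> ?B"
        using that \<open>0 < r\<close> scale[of r b] scale[of "- r" b] by auto
      then have "u \<bullet> (c + r *\<^sub>R b) \<le> u \<bullet> x" "u \<bullet> y \<le> u \<bullet> (c + (- r) *\<^sub>R b)"
        using x y bdd unfolding upper_hyperplane_def lower_hyperplane_def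
        by (auto intro!: cSUP_upper cINF_lower bounded_imp_bdd_above bounded_imp_bdd_below
            simp del: scaleR_minus_left)
      then show ?thesis by (simp add: algebra_simps)
    qed
    \<comment> \<open>Taking \<open>b\<close> along \<open>u\<close> shows
      \<open>x \<noteq> y\<close>, so that \<open>x - y\<close> can be normalised and used as
      \<open>b\<close> next; the factor \<open>u \<bullet> (x - y)\<close> then cancels.\<close>
    have "0 < 2 * r * (u \<bullet> ((1 / N u) *\<^sub>R u))"
      using u pos[OF u] \<open>0 < r\<close> by simp
    also have "\<dots> \<le> u \<bullet> (x - y)"
      using pos[OF u] by (intro ineq) (simp add: scale)
    finally have less: "0 < u \<bullet> (x - y)" .
    then have "x - y \<noteq> 0" by auto
    then have "0 < N (x - y)" by (rule pos)
    moreover from this have "2 * r * (u \<bullet> ((1 / N (x - y)) *\<^sub>R (x - y))) \<le> u \<bullet> (x - y)"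
      by (intro ineq) (simp only: scale, simp)
    ultimately have "2 * r * (u \<bullet> (x - y)) \<le> N (x - y) * (u \<bullet> (x - y))"
      by (simp only: inner_scaleR_right) (simp add: field_simps)
    then show "2 * r \<le> N (x - y)" using less by simp
  qed
qed

section \<open>Convexity and completeness of the simplex\<close>

lemma vertices_in_corner_simplex: "0 \<in> corner_simplex" "axis i 1 \<in> corner_simplex"
  by (auto simp: corner_simplex_def axis_def)

lemma corner_simplex_component_le_1:
  assumes "x \<in> corner_simplex"
  shows "x $ i \<le> 1"
  using assms member_le_sum[of i UNIV "($) x"] by (force simp: corner_simplex_def)

lemma compact_corner_simplex: "compact (corner_simplex :: (real ^ 'n) set)"
  unfolding compact_eq_bounded_closed
proof
  show "bounded (corner_simplex :: (real ^ 'n) set)"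
  proof (rule boundedI)
    fix x :: "real ^ 'n" assume "x \<in> corner_simplex"
    then show "norm x \<le> 1"
      using norm_le_l1_cart[of x] by (simp add: corner_simplex_def)
  qed
  show "closed (corner_simplex :: (real ^ 'n) set)"
    unfolding corner_simplex_def
    by (intro closed_Collect_conj closed_Collect_all closed_Collect_le continuous_intros)
qed

lemma convex_corner_simplex: "convex (corner_simplex :: (real ^ 'n) set)"
proof (rule convexI)
  fix x y :: "real ^ 'n" and u v :: real
  assume *: "x \<in> corner_simplex" "y \<in> corner_simplex" "0 \<le> u" "0 \<le> v" "u + v = 1"
  then have "u * (\<Sum>i\<in>UNIV. x $ i) + v * (\<Sum>i\<in>UNIV. y $ i) \<le> u * 1 + v * 1"
    unfolding corner_simplex_def by (intro add_mono mult_left_mono) auto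
  then show "u *\<^sub>R x + v *\<^sub>R y \<in> corner_simplex"
    using * by (simp add: corner_simplex_def sum.distrib flip: sum_distrib_left)
qed

lemma diametrically_complete_corner_simplex:
  "diametrically_complete simplex_norm (corner_simplex :: (real ^ 'n) set)"
  unfolding diametrically_complete_def
proof (intro notI, elim exE conjE)
  let ?T = "corner_simplex :: (real ^ 'n) set"
  fix D assume D: "compact D" "?T \<subset> D"
    and eq: "norm_diameter simplex_norm D = norm_diameter simplex_norm ?T"
  have "norm_diameter simplex_norm ?T \<le> 1"
    unfolding norm_diameter_def
  proof (rule cSup_least)
    show "{simplex_norm (x - y) |x y. x \<in> ?T \<and> y \<in> ?T} \<noteq> {}"
      using vertices_in_corner_simplex(1) by blast
    fix r assume "r \<in> {simplex_norm (x - y) |x y. x \<in> ?T \<and> y \<in> ?T}"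
    then obtain x y where r: "r = simplex_norm (x - y)" and xy: "x \<in> ?T" "y \<in> ?T" by blast
    have "\<bar>x $ i - y $ i\<bar> \<le> 1" for i
      using corner_simplex_component_le_1[OF xy(1), of i] corner_simplex_component_le_1[OF xy(2), of i] xy
      by (simp add: corner_simplex_def abs_le_iff) (smt (verit))
    moreover have "0 \<le> (\<Sum>i\<in>UNIV. x $ i)" "0 \<le> (\<Sum>i\<in>UNIV. y $ i)"
      using xy by (auto simp: corner_simplex_def intro: sum_nonneg)
    ultimately show "r \<le> 1"
      using xy unfolding r
      by (simp add: simplex_norm_le_iff sum_subtractf corner_simplex_def abs_le_iff)
  qed
  moreover obtain x v where x: "x \<in> D" and v: "v \<in> D" and far: "1 < simplex_norm (x - v)"
  proof -
    obtain x where x: "x \<in> D" "x \<notin> ?T" using D by blast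
    \<comment> \<open>The partner of \<open>x\<close> is the vertex opposite the violated facet:
      \<open>axis i 1\<close> for a negative component, and \<open>0\<close>, where
      \<open>f\<^sub>0 = 1\<close>, for too large a sum.\<close>
    then consider i where "x $ i < 0" | "(\<Sum>i\<in>UNIV. x $ i) > 1"
      by (force simp: corner_simplex_def not_le)
    then show thesis
    proof cases
      case 1
      then show thesis
        using abs_component_le_simplex_norm[of "x - axis i 1" i] that[of x "axis i 1"] x D
          vertices_in_corner_simplex(2)[of i]
        by auto
    next
      case 2
      then show thesis
        using abs_sum_le_simplex_norm[of x] that[of x 0] x D vertices_in_corner_simplex(1) by auto
    qed
  qed
  moreover have "simplex_norm (x - v) \<le> norm_diameter simplex_norm D"
    unfolding norm_diameter_def
  proof (rule cSup_upper)
    obtain b where b: "norm z \<le> b" if "z \<in> D" for z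
      using compact_imp_bounded[OF D(1)] by (auto simp: bounded_iff)
    show "bdd_above {simplex_norm (x - y) |x y. x \<in> D \<and> y \<in> D}"
    proof (rule bdd_aboveI)
      fix r assume "r \<in> {simplex_norm (x - y) |x y. x \<in> D \<and> y \<in> D}"
      then obtain x y where r: "r = simplex_norm (x - y)" and "x \<in> D" "y \<in> D" by blast
      then have "norm (x - y) \<le> b + b"
        using norm_triangle_ineq4[of x y] b[of x] b[of y] by linarith
      then show "r \<le> real CARD('n) * (b + b)"
        unfolding r by (intro order_trans[OF simplex_norm_le_norm] mult_left_mono) auto
    qed
  qed (use x v in blast)
  ultimately show False using eq by simp
qed

section \<open>Thickness of the simplex and the inscribed ball\<close>

lemma thickness_corner_simplex_le:
  assumes "odd CARD('n)"
  shows "thickness simplex_norm (corner_simplex :: (real ^ 'n) set) \<le> 2 / (real CARD('n) + 1)"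
proof -
  let ?T = "corner_simplex :: (real ^ 'n) set" and ?r = "2 / (real CARD('n) + 1)"
  obtain m where m: "CARD('n) = 2 * m + 1" using assms by (auto elim: oddE)
  \<comment> \<open>\<open>m + 1\<close> is half of the \<open>2 * m + 2\<close> barycentric
    coordinates; \<open>f\<^sub>0\<close> is left out of the chosen half, so their sum is
    linear.\<close>
  obtain A :: "'n set" where A: "card A = m + 1"
    using obtain_subset_with_card_n[of "m + 1" "UNIV :: 'n set"] m by auto
  then obtain j where j: "j \<in> A" by fastforce
  define u :: "real ^ 'n" where "u = (\<chi> i. if i \<in> A then 1 else 0)"
  \<comment> \<open>\<open>z\<close> maximises \<open>u\<close> on the ball of radius
    \<open>?r\<close> about \<open>0\<close>: the linear parts of the coordinates in
    \<open>A\<close> are \<open>?r\<close>, those of the \<open>m\<close> others and of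
    \<open>f\<^sub>0\<close> are \<open>- ?r\<close>. As \<open>?r = 1 / (m + 1)\<close>,
    \<open>z\<close> lies on the upper hyperplane; \<open>0\<close> lies on the lower one.\<close>
  define z :: "real ^ 'n" where "z = (\<chi> i. if i \<in> A then ?r else - ?r)"
  have u_inner: "u \<bullet> x = (\<Sum>i\<in>A. x $ i)" for x
    by (simp add: u_def inner_vec_def if_distrib[of "\<lambda>t. t * _"] sum.If_cases cong: if_cong)
  have range: "0 \<le> u \<bullet> x" "u \<bullet> x \<le> 1" if "x \<in> ?T" for x
  proof -
    show "0 \<le> u \<bullet> x" using that unfolding u_inner by (auto simp: corner_simplex_def intro: sum_nonneg)
    have "u \<bullet> x \<le> (\<Sum>i\<in>UNIV. x $ i)"
      using that unfolding u_inner by (intro sum_mono2) (auto simp: corner_simplex_def)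
    then show "u \<bullet> x \<le> 1" using that by (simp add: corner_simplex_def)
  qed
  have "u \<bullet> axis j 1 = 1" using j by (simp add: u_def inner_axis)
  then have "(SUP y\<in>?T. u \<bullet> y) = 1"
    using range(2) vertices_in_corner_simplex(2)[of j] by (intro cSup_eq_maximum) force+
  moreover have "(INF y\<in>?T. u \<bullet> y) = 0"
    using range(1) vertices_in_corner_simplex(1) by (intro cInf_eq_minimum) force+
  moreover have "u \<bullet> z = 1"
    using A m by (simp add: u_inner z_def field_simps)
  moreover have "u \<noteq> 0" using \<open>u \<bullet> axis j 1 = 1\<close> by auto
  ultimately have "thickness simplex_norm ?T \<le> simplex_norm (z - 0)"
    by (intro thickness_le[OF is_norm_simplex_norm])
      (auto simp: upper_hyperplane_def lower_hyperplane_def)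
  moreover have "card (- A) = m" using A m by (simp add: Compl_eq_Diff_UNIV card_Diff_subset)
  then have "(\<Sum>i\<in>UNIV. z $ i) = ?r"
    using A by (simp add: z_def sum.If_cases distrib_left add_divide_distrib)
  then have "simplex_norm z \<le> ?r" by (simp add: simplex_norm_le_iff z_def)
  ultimately show ?thesis by simp
qed

text \<open>All barycentric coordinates of \<open>c\<close>, including \<open>f\<^sub>0\<close>,
  equal \<open>r\<close>; a displacement of norm at most \<open>r\<close> changes each by at most
  \<open>r\<close>, so none becomes negative.\<close>

lemma inscribed_ball_psubset_corner_simplex:
  fixes c :: "real ^ 'n"
  defines "r \<equiv> 1 / (real CARD('n) + 1)"
  assumes "1 < CARD('n)" and c: "c = (\<chi> i. r)"
  shows "{x. simplex_norm (x - c) \<le> r} \<subset> corner_simplex" (is "?B \<subset> _")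
proof
  have sum_c: "(\<Sum>i\<in>UNIV. c $ i) + r = 1"
    by (simp add: c r_def field_simps)
  show "?B \<subseteq> corner_simplex"
  proof
    fix x assume "x \<in> ?B"
    then have "\<bar>x $ i - r\<bar> \<le> r" "\<bar>(\<Sum>i\<in>UNIV. x $ i) - (\<Sum>i\<in>UNIV. c $ i)\<bar> \<le> r" for i
      by (auto simp: simplex_norm_le_iff c sum_subtractf)
    then show "x \<in> corner_simplex"
      using sum_c by (simp add: corner_simplex_def abs_le_iff)
  qed
  \<comment> \<open>A vertex has distance at least \<open>1 - r\<close> from \<open>c\<close>, which
    exceeds \<open>r\<close> in dimension greater than one; on a line the ball would be the whole
    simplex.\<close>
  have "axis i 1 \<notin> ?B" for i
    using abs_component_le_simplex_norm[of "axis i 1 - c" i] assms(2)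
    by (auto simp: c r_def field_simps split: abs_split)
  then show "?B \<noteq> corner_simplex" using vertices_in_corner_simplex(2) by blast
qed

theorem mainTheorem1:
  fixes k :: nat
  assumes "k \<ge> 2" and "CARD('n::finite) = 2 ^ k - 1"
  shows "\<exists>(N :: real ^ 'n \<Rightarrow> real) (K :: (real ^ 'n) set).
           is_norm N \<and> convex_body K \<and> diametrically_complete N K \<and> \<not> reduced_in N K"
proof (intro exI conjI)
  let ?T = "corner_simplex :: (real ^ 'n) set" and ?r = "1 / (real CARD('n) + 1)"
  let ?B = "{x :: real ^ 'n. simplex_norm (x - (\<chi> i. ?r)) \<le> ?r}"
  have odd: "odd CARD('n)" using assms by simp
  have "(2::nat) ^ 2 \<le> 2 ^ k" using assms(1) by (intro power_increasing) auto
  then have "1 < CARD('n)" using assms(2) by simp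
  then have sub: "?B \<subset> ?T" by (intro inscribed_ball_psubset_corner_simplex) auto
  have B: "convex_body ?B" by (rule convex_body_simplex_ball) simp
  show "is_norm (simplex_norm :: real ^ 'n \<Rightarrow> real)" by (rule is_norm_simplex_norm)
  \<comment> \<open>The simplex inherits its nonempty interior from the inscribed ball.\<close>
  show "convex_body ?T"
    using B interior_mono[of ?B ?T] sub compact_corner_simplex convex_corner_simplex
    unfolding convex_body_def by blast
  show "diametrically_complete simplex_norm ?T" by (rule diametrically_complete_corner_simplex)
  \<comment> \<open>The proper subbody \<open>?B\<close> is at least as thick as \<open>?T\<close>,
    which contradicts reducedness.\<close>
  have "thickness simplex_norm ?T \<le> 2 * ?r"
    using thickness_corner_simplex_le[OF odd] by simp
  also have "\<dots> \<le> thickness simplex_norm ?B"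
    using B by (intro thickness_ball_ge is_norm_simplex_norm) (auto simp: convex_body_def)
  finally show "\<not> reduced_in simplex_norm ?T"
    using B sub unfolding reduced_in_def by (meson not_le)
qed

end
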